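(* Let $M$ be a matrix, let $\sigma$ be a substitution, and let $\Gamma$ be a spanning set of connections for $(M,\sigma)$. Suppose that $M$ is minimal, i.e. there is no strict subset $M' \subsetneq M$ for which there exist a substitution $\sigma'$ and a spanning set of connections for $(M',\sigma')$. Then $M$ is fully connected with respect to $\Gamma$: every literal occurrence $(C,L)$ with $C\in M$, $L\in C$ lies in some connection $\{(C,L),(D,K)\}\in\Gamma$ (necessarily with $D\neq C$).
   Context: Work in classical first-order logic. A clause is a finite set of literals (read as their disjunction). A matrix is a finite set of clauses whose variables are pairwise disjoint (each clause is a variable-renamed copy of an input clause, and the clauses are renamed apart). A single global substitution $\sigma$ is applied to the whole matrix. A literal occurrence of $M$ is a pair $(C,L)$ with $C\in M$ and $L\in C$. Two literals are connected (modulo $\sigma$) if $\sigma(L)$ and $\sigma(K)$ have the same atom and opposite polarity. A connection for $(M,\sigma)$ is an unordered pair $\{(C,L),(D,K)\}$ of literal occurrences with $C\neq D$ such that $\sigma(L)$ and $\sigma(K)$ are complementary; a set of connections for $(M,\sigma)$ is a set $\Gamma$ of such pairs. A path through $M$ is a set of literal occurrences containing exactly one occurrence from each clause of $M$. A path is open with respect to $\Gamma$ if it contains no pair belonging to $\Gamma$, and closed otherwise. $\Gamma$ is spanning if no path through $M$ is open with respect to $\Gamma$. *)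

theory Defs
  imports Main
begin

text \<open>Symbols are not given fixed arities: an occurrence with \<open>n\<close> arguments is read as an
  occurrence of the \<open>n\<close>-ary symbol of that name.\<close>

datatype (trm_funs: 'f, trm_vars: 'v) trm =
    Var 'v
  | Fun 'f "('f, 'v) trm list"

datatype (atom_preds: 'p, atom_funs: 'f, atom_vars: 'v) atom =
    Atom 'p "('f, 'v) trm list"

datatype (lit_preds: 'p, lit_funs: 'f, lit_vars: 'v) literal =
    is_pos: Pos (atom_of: "('p, 'f, 'v) atom")
  | is_neg: Neg (atom_of: "('p, 'f, 'v) atom")

type_synonym ('f, 'v) subst = "'v \<Rightarrow> ('f, 'v) trm"
type_synonym ('p, 'f, 'v) clause = "('p, 'f, 'v) literal set"
type_synonym ('p, 'f, 'v) occ = "('p, 'f, 'v) clause \<times> ('p, 'f, 'v) literal"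

primrec subst_trm :: "('f, 'v) subst \<Rightarrow> ('f, 'v) trm \<Rightarrow> ('f, 'v) trm" where
  "subst_trm \<sigma> (Var x) = \<sigma> x"
| "subst_trm \<sigma> (Fun f ts) = Fun f (map (subst_trm \<sigma>) ts)"

primrec subst_atom :: "('f, 'v) subst \<Rightarrow> ('p, 'f, 'v) atom \<Rightarrow> ('p, 'f, 'v) atom" where
  "subst_atom \<sigma> (Atom p ts) = Atom p (map (subst_trm \<sigma>) ts)"

primrec subst_lit :: "('f, 'v) subst \<Rightarrow> ('p, 'f, 'v) literal \<Rightarrow> ('p, 'f, 'v) literal" where
  "subst_lit \<sigma> (Pos A) = Pos (subst_atom \<sigma> A)"
| "subst_lit \<sigma> (Neg A) = Neg (subst_atom \<sigma> A)"

definition complementary :: "('p, 'f, 'v) literal \<Rightarrow> ('p, 'f, 'v) literal \<Rightarrow> bool" where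
  "complementary L K \<longleftrightarrow> atom_of L = atom_of K \<and> is_pos L \<noteq> is_pos K"

definition clause_vars :: "('p, 'f, 'v) clause \<Rightarrow> 'v set" where
  "clause_vars C = (\<Union>L\<in>C. lit_vars L)"

text \<open>The input clauses of which the members of \<open>M\<close> are renamed copies are left implicit: every set
  of clauses satisfying the conditions below arises in this way, from its own members.\<close>

definition is_matrix :: "('p, 'f, 'v) clause set \<Rightarrow> bool" where
  "is_matrix M \<longleftrightarrow> finite M \<and> (\<forall>C\<in>M. finite C) \<and>
     pairwise (\<lambda>C D. disjnt (clause_vars C) (clause_vars D)) M"

definition occurrences :: "('p, 'f, 'v) clause set \<Rightarrow> ('p, 'f, 'v) occ set" where
  "occurrences M = {(C, L). C \<in> M \<and> L \<in> C}"

definition connections ::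
    "('p, 'f, 'v) clause set \<Rightarrow> ('f, 'v) subst \<Rightarrow> ('p, 'f, 'v) occ set set" where
  "connections M \<sigma> =
     {{(C, L), (D, K)} | C L D K.
        (C, L) \<in> occurrences M \<and> (D, K) \<in> occurrences M \<and> C \<noteq> D \<and>
        complementary (subst_lit \<sigma> L) (subst_lit \<sigma> K)}"

definition is_path :: "('p, 'f, 'v) clause set \<Rightarrow> ('p, 'f, 'v) occ set \<Rightarrow> bool" where
  "is_path M P \<longleftrightarrow> P \<subseteq> occurrences M \<and> (\<forall>C\<in>M. \<exists>!L. (C, L) \<in> P)"

definition path_open :: "('p, 'f, 'v) occ set set \<Rightarrow> ('p, 'f, 'v) occ set \<Rightarrow> bool" where
  "path_open \<Gamma> P \<longleftrightarrow> \<not> (\<exists>c\<in>\<Gamma>. c \<subseteq> P)"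

definition spanning_connections ::
    "('p, 'f, 'v) clause set \<Rightarrow> ('f, 'v) subst \<Rightarrow> ('p, 'f, 'v) occ set set \<Rightarrow> bool" where
  "spanning_connections M \<sigma> \<Gamma> \<longleftrightarrow>
     \<Gamma> \<subseteq> connections M \<sigma> \<and> \<not> (\<exists>P. is_path M P \<and> path_open \<Gamma> P)"

definition minimal_matrix :: "('p, 'f, 'v) clause set \<Rightarrow> bool" where
  "minimal_matrix M \<longleftrightarrow> \<not> (\<exists>M' \<sigma>' \<Gamma>'. M' \<subset> M \<and> spanning_connections M' \<sigma>' \<Gamma>')"

definition fully_connected ::
    "('p, 'f, 'v) clause set \<Rightarrow> ('p, 'f, 'v) occ set set \<Rightarrow> bool" where
  "fully_connected M \<Gamma> \<longleftrightarrow>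
     (\<forall>(C, L)\<in>occurrences M. \<exists>(D, K)\<in>occurrences M. D \<noteq> C \<and> {(C, L), (D, K)} \<in> \<Gamma>)"

end

theory Submission
  imports Defs
begin

text \<open>Suppose the occurrence \<open>(C, L)\<close> lies in no connection of \<open>\<Gamma>\<close>. By minimality the connections of
  \<open>\<Gamma>\<close> that avoid \<open>C\<close> do not span \<open>M - {C}\<close>, so some path through \<open>M - {C}\<close> contains none of them.
  Extended by \<open>(C, L)\<close> it is a path through \<open>M\<close>, and it is still open: a connection of \<open>\<Gamma>\<close> on it
  would have to use \<open>(C, L)\<close>.\<close>

lemma is_path_insert:
  assumes "is_path (M - {C}) P" "C \<in> M" "L \<in> C"
  shows "is_path M (insert (C, L) P)"
proof -
  have P: "P \<subseteq> occurrences (M - {C})" and ex1: "\<And>D. D \<in> M - {C} \<Longrightarrow> \<exists>!K. (D, K) \<in> P"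
    using assms(1) by (auto simp: is_path_def)
  \<comment> \<open>No occurrence from the clause \<open>C\<close> is in \<open>P\<close>, so the
    inserted one is unique there.\<close>
  have "(C, K) \<notin> P" for K
    using P by (auto simp: occurrences_def)
  moreover have "\<exists>!K. (D, K) \<in> insert (C, L) P" if "D \<in> M" "D \<noteq> C" for D
    using ex1[of D] that by simp
  ultimately have "\<exists>!K. (D, K) \<in> insert (C, L) P" if "D \<in> M" for D
    using that by (cases "D = C") auto
  moreover have "insert (C, L) P \<subseteq> occurrences M"
    using P assms(2,3) by (auto simp: occurrences_def)
  ultimately show ?thesis
    by (simp add: is_path_def)
qed

text \<open>Complementarity under \<open>\<sigma>\<close> does not mention the matrix; only the
  location of the two endpoints ties a connection to it.\<close>

lemma connections_restrict:
  assumes "c \<in> connections M \<sigma>" "c \<subseteq> occurrences N"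
  shows "c \<in> connections N \<sigma>"
proof -
  obtain C L D K where c: "c = {(C, L), (D, K)}" "C \<noteq> D"
    "complementary (subst_lit \<sigma> L) (subst_lit \<sigma> K)"
    using assms(1) by (auto simp: connections_def)
  moreover have "(C, L) \<in> occurrences N" "(D, K) \<in> occurrences N"
    using assms(2) c(1) by auto
  ultimately show ?thesis
    unfolding connections_def by blast
qed

text \<open>A connection is an unordered pair, so \<open>(C, L)\<close> may be either endpoint of
  the representation obtained; the second case swaps them.\<close>

lemma connection_partner:
  assumes "c \<in> connections M \<sigma>" "(C, L) \<in> c"
  obtains D K where "(D, K) \<in> occurrences M" "D \<noteq> C" "c = {(C, L), (D, K)}"
proof -
  obtain C1 L1 C2 L2 where c: "c = {(C1, L1), (C2, L2)}" and "C1 \<noteq> C2"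
    and occ: "(C1, L1) \<in> occurrences M" "(C2, L2) \<in> occurrences M"
    using assms(1) by (auto simp: connections_def)
  consider "(C, L) = (C1, L1)" | "(C, L) = (C2, L2)"
    using assms(2) c by blast
  then show thesis
  proof cases
    case 1
    then show thesis
      using that[of C2 L2] c occ \<open>C1 \<noteq> C2\<close> by simp
  next
    case 2
    then show thesis
      using that[of C1 L1] c occ \<open>C1 \<noteq> C2\<close> by (simp add: insert_commute)
  qed
qed

theorem theorem1:
  fixes M :: "('p, 'f, 'v) clause set"
    and \<sigma> :: "('f, 'v) subst"
    and \<Gamma> :: "('p, 'f, 'v) occ set set"
  assumes "is_matrix M"
    and "spanning_connections M \<sigma> \<Gamma>"
    and "minimal_matrix M"
  shows "fully_connected M \<Gamma>"
proof -
  have \<Gamma>: "\<Gamma> \<subseteq> connections M \<sigma>" and closed: "\<And>P. is_path M P \<Longrightarrow> \<exists>c\<in>\<Gamma>. c \<subseteq> P"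
    using assms(2) unfolding spanning_connections_def path_open_def by blast+
  have "\<exists>(D, K)\<in>occurrences M. D \<noteq> C \<and> {(C, L), (D, K)} \<in> \<Gamma>" if "C \<in> M" "L \<in> C" for C L
  proof -
    \<comment> \<open>The intersection is a set of connections for \<open>M - {C}\<close> by
      construction, so it can fail to span only through an open path.\<close>
    let ?\<Gamma>' = "\<Gamma> \<inter> connections (M - {C}) \<sigma>"
    have "M - {C} \<subset> M"
      using \<open>C \<in> M\<close> by blast
    then have "\<not> spanning_connections (M - {C}) \<sigma> ?\<Gamma>'"
      using assms(3) unfolding minimal_matrix_def by blast
    then obtain P where path: "is_path (M - {C}) P" and P_open: "path_open ?\<Gamma>' P"
      unfolding spanning_connections_def by blast
    obtain c where c: "c \<in> \<Gamma>" "c \<subseteq> insert (C, L) P"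
      using closed[OF is_path_insert[OF path \<open>C \<in> M\<close> \<open>L \<in> C\<close>]] by blast
    have "(C, L) \<in> c"
    proof (rule ccontr)
      assume "(C, L) \<notin> c"
      then have "c \<subseteq> P"
        using c(2) by blast
      \<comment> \<open>Both endpoints of \<open>c\<close> avoid the clause \<open>C\<close>, so
        \<open>c\<close> survives in \<open>?\<Gamma>'\<close> and closes \<open>P\<close>.\<close>
      then have "c \<subseteq> occurrences (M - {C})"
        using path unfolding is_path_def by blast
      then have "c \<in> ?\<Gamma>'"
        using connections_restrict[OF subsetD[OF \<Gamma> c(1)]] c(1) by simp
      then show False
        using P_open \<open>c \<subseteq> P\<close> unfolding path_open_def by blast
    qed
    with subsetD[OF \<Gamma> c(1)] obtain D K
      where "(D, K) \<in> occurrences M" "D \<noteq> C" "c = {(C, L), (D, K)}"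
      by (rule connection_partner)
    then show ?thesis
      using c(1) by blast
  qed
  then show ?thesis
    by (auto simp: fully_connected_def occurrences_def)
qed

end
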